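(* Let $(X,d_{\mathbb{D}})$ and $(Y,\rho_{\mathbb{D}})$ be two $\mathbb{D}$-metric spaces and assume that $X$ is $\mathbb{D}$-compact. Let $C_{\mathbb{D}}(X,Y)$ be the set of all $\mathbb{D}$-continuous functions $f:X\to Y$. Then $$\sigma_{\mathbb{D}}(f,g)=\sup\{\rho_{\mathbb{D}}(f(x),g(x)) : x\in X\}$$ defines a $\mathbb{D}$-metric $\sigma_{\mathbb{D}}$ on $C_{\mathbb{D}}(X,Y)$. Also, if $(Y,\rho_{\mathbb{D}})$ is $\mathbb{D}$-complete, so is $(C_{\mathbb{D}}(X,Y),\sigma_{\mathbb{D}})$.
   Context: Hyperbolic numbers: $\mathbb{D}=\{a_1+\mathbf{k}a_2: a_1,a_2\in\mathbb{R}\}$ with $\mathbf{k}^2=1$, a commutative ring. With $\mathbf{e}_1=\frac{1+\mathbf{k}}{2}$, $\mathbf{e}_2=\frac{1-\mathbf{k}}{2}$, every $\alpha\in\mathbb{D}$ is uniquely $\alpha=\alpha_1\mathbf{e}_1+\alpha_2\mathbf{e}_2$ with $\alpha_1,\alpha_2\in\mathbb{R}$; sums and products are computed componentwise. Write $\alpha\preceq\beta$ if $\alpha_1\le\beta_1$ and $\alpha_2\le\beta_2$, and $\alpha\prec\beta$ if $\alpha_1<\beta_1$ and $\alpha_2<\beta_2$. Let $\mathbb{D}^+=\{\alpha:\alpha_1,\alpha_2>0\}$ and $\mathbb{D}_0^+=\{\alpha:\alpha_1,\alpha_2\ge 0\}$. For $A\subset\mathbb{D}$, $\sup A=(\sup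 A_{\mathbf{e}_1})\mathbf{e}_1+(\sup A_{\mathbf{e}_2})\mathbf{e}_2$, where $A_{\mathbf{e}_1}$ and $A_{\mathbf{e}_2}$ are the sets of first and second components of elements of $A$. A $\mathbb{D}$-metric on a nonempty set $X$ is a function $d_{\mathbb{D}}:X\times X\to\mathbb{D}_0^+$ such that for all $x,y,z\in X$: $d_{\mathbb{D}}(x,y)=0$ iff $x=y$; $d_{\mathbb{D}}(x,y)=d_{\mathbb{D}}(y,x)$; $d_{\mathbb{D}}(x,y)\preceq d_{\mathbb{D}}(x,z)+d_{\mathbb{D}}(z,y)$. Then $(X,d_{\mathbb{D}})$ is a $\mathbb{D}$-metric space. A sequence $\{x_n\}$ in $X$ converges to $\alpha\in X$ if for every $\epsilon\in\mathbb{D}^+$ there is $N\in\mathbb{N}$ with $d_{\mathbb{D}}(x_n,\alpha)\prec\epsilon$ for all $n\ge N$. It is $\mathbb{D}$-Cauchy if for every $\epsilon\in\mathbb{D}^+$ there is $N$ with $d_{\mathbb{D}}(x_n,x_m)\prec\epsilon$ for all $n,m\ge N$. A $\mathbb{D}$-metric space is $\mathbb{D}$-complete if every $\mathbb{D}$-Cauchy sequence in it converges to a point of it, and $\mathbb{D}$-compact if every sequence in it has a subsequence converging to a point of it. A function $f:X\to Y$ is $\mathbb{D}$-continuous if for every $\alpha\in X$ and every $\epsilon\in\mathbb{D}^+$ there is $\delta\in\mathbb{D}^+$ such that $\rho_{\mathbb{D}}(f(x),f(\alpha))\prec\epsilon$ whenever $d_{\mathbb{D}}(x,\alpha)\prec\delta$.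 *)

theory Defs
  imports Complex_Main "HOL-Library.FuncSet"
begin

section \<open>Hyperbolic numbers\<close>

text \<open>\<open>Hyp a b\<close> stands for the number \<open>a + k b\<close> with \<open>k\<^sup>2 = 1\<close>.\<close>

datatype hyperbolic = Hyp (hyp_re: real) (hyp_im: real)

lemma hyperbolic_eq_iff: "x = y \<longleftrightarrow> hyp_re x = hyp_re y \<and> hyp_im x = hyp_im y"
  by (auto intro: hyperbolic.expand)

instantiation hyperbolic :: comm_ring_1
begin

definition "0 = Hyp 0 0"
definition "1 = Hyp 1 0"
definition "x + y = Hyp (hyp_re x + hyp_re y) (hyp_im x + hyp_im y)"
definition "- x = Hyp (- hyp_re x) (- hyp_im x)"
definition "x - y = Hyp (hyp_re x - hyp_re y) (hyp_im x - hyp_im y)"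
definition "x * y = Hyp (hyp_re x * hyp_re y + hyp_im x * hyp_im y)
                        (hyp_re x * hyp_im y + hyp_im x * hyp_re y)"

instance
  by standard
    (simp_all add: zero_hyperbolic_def one_hyperbolic_def plus_hyperbolic_def
      uminus_hyperbolic_def minus_hyperbolic_def times_hyperbolic_def algebra_simps)

end

instantiation hyperbolic :: real_algebra_1
begin

definition "scaleR r x = Hyp (r * hyp_re x) (r * hyp_im x)"

instance
  by standard
    (simp_all add: scaleR_hyperbolic_def plus_hyperbolic_def times_hyperbolic_def algebra_simps)

end

lemmas hyperbolic_ops_defs =
  zero_hyperbolic_def one_hyperbolic_def plus_hyperbolic_def uminus_hyperbolic_def
  minus_hyperbolic_def times_hyperbolic_def scaleR_hyperbolic_def

definition hyp_k :: hyperbolic where "hyp_k = Hyp 0 1"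

definition hyp_e1 :: hyperbolic where "hyp_e1 = (1 / 2) *\<^sub>R (1 + hyp_k)"

definition hyp_e2 :: hyperbolic where "hyp_e2 = (1 / 2) *\<^sub>R (1 - hyp_k)"

lemma hyp_k_square: "hyp_k * hyp_k = 1"
  by (simp add: hyp_k_def hyperbolic_ops_defs)

lemma Hyp_eq: "Hyp a b = of_real a + hyp_k * of_real b"
  by (simp add: of_real_def hyp_k_def hyperbolic_ops_defs)

text \<open>The real coordinates with respect to the idempotents \<open>hyp_e1\<close>, \<open>hyp_e2\<close>; see
  \<open>hyp_idempotent_decomposition\<close> below.\<close>

definition comp1 :: "hyperbolic \<Rightarrow> real" where "comp1 x = hyp_re x + hyp_im x"

definition comp2 :: "hyperbolic \<Rightarrow> real" where "comp2 x = hyp_re x - hyp_im x"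

lemma hyp_idempotent_decomposition:
  "x = a *\<^sub>R hyp_e1 + b *\<^sub>R hyp_e2 \<longleftrightarrow> a = comp1 x \<and> b = comp2 x"
  by (auto simp: hyperbolic_eq_iff comp1_def comp2_def hyp_e1_def hyp_e2_def hyp_k_def
      hyperbolic_ops_defs field_simps)

lemma comp_simps [simp]:
  "comp1 0 = 0" "comp2 0 = 0"
  "comp1 (x + y) = comp1 x + comp1 y" "comp2 (x + y) = comp2 x + comp2 y"
  "comp1 (x * y) = comp1 x * comp1 y" "comp2 (x * y) = comp2 x * comp2 y"
  by (simp_all add: comp1_def comp2_def hyperbolic_ops_defs algebra_simps)

text \<open>The strict relation demands strict inequality in both components, so it is not the strict
  part of the non-strict one; hence no instance of the order classes.\<close>

definition hyp_le :: "hyperbolic \<Rightarrow> hyperbolic \<Rightarrow> bool" (infix "\<preceq>\<^sub>D" 50) where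
  "x \<preceq>\<^sub>D y \<longleftrightarrow> comp1 x \<le> comp1 y \<and> comp2 x \<le> comp2 y"

definition hyp_less :: "hyperbolic \<Rightarrow> hyperbolic \<Rightarrow> bool" (infix "\<prec>\<^sub>D" 50) where
  "x \<prec>\<^sub>D y \<longleftrightarrow> comp1 x < comp1 y \<and> comp2 x < comp2 y"

definition hyp_pos :: "hyperbolic set" where
  "hyp_pos = {x. 0 < comp1 x \<and> 0 < comp2 x}"

definition hyp_nonneg :: "hyperbolic set" where
  "hyp_nonneg = {x. 0 \<le> comp1 x \<and> 0 \<le> comp2 x}"

definition hyp_bdd_above :: "hyperbolic set \<Rightarrow> bool" where
  "hyp_bdd_above A \<longleftrightarrow> (\<exists>b. \<forall>a\<in>A. a \<preceq>\<^sub>D b)"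

text \<open>Meaningful only for nonempty \<open>A\<close> with \<open>hyp_bdd_above A\<close>; otherwise the real \<open>Sup\<close>
  is unspecified.\<close>

definition hyp_Sup :: "hyperbolic set \<Rightarrow> hyperbolic" where
  "hyp_Sup A = Sup (comp1 ` A) *\<^sub>R hyp_e1 + Sup (comp2 ` A) *\<^sub>R hyp_e2"


section \<open>Metric spaces with hyperbolic distances\<close>

definition D_metric_space :: "'a set \<Rightarrow> ('a \<Rightarrow> 'a \<Rightarrow> hyperbolic) \<Rightarrow> bool" where
  "D_metric_space X d \<longleftrightarrow>
     X \<noteq> {} \<and>
     (\<forall>x\<in>X. \<forall>y\<in>X. d x y \<in> hyp_nonneg) \<and>
     (\<forall>x\<in>X. \<forall>y\<in>X. d x y = 0 \<longleftrightarrow> x = y) \<and>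
     (\<forall>x\<in>X. \<forall>y\<in>X. d x y = d y x) \<and>
     (\<forall>x\<in>X. \<forall>y\<in>X. \<forall>z\<in>X. d x y \<preceq>\<^sub>D d x z + d z y)"

definition D_converges :: "('a \<Rightarrow> 'a \<Rightarrow> hyperbolic) \<Rightarrow> (nat \<Rightarrow> 'a) \<Rightarrow> 'a \<Rightarrow> bool" where
  "D_converges d s a \<longleftrightarrow> (\<forall>\<epsilon>\<in>hyp_pos. \<exists>N. \<forall>n\<ge>N. d (s n) a \<prec>\<^sub>D \<epsilon>)"

definition D_Cauchy :: "('a \<Rightarrow> 'a \<Rightarrow> hyperbolic) \<Rightarrow> (nat \<Rightarrow> 'a) \<Rightarrow> bool" where
  "D_Cauchy d s \<longleftrightarrow> (\<forall>\<epsilon>\<in>hyp_pos. \<exists>N. \<forall>n\<ge>N. \<forall>m\<ge>N. d (s n) (s m) \<prec>\<^sub>D \<epsilon>)"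

definition D_complete :: "'a set \<Rightarrow> ('a \<Rightarrow> 'a \<Rightarrow> hyperbolic) \<Rightarrow> bool" where
  "D_complete X d \<longleftrightarrow>
     (\<forall>s. range s \<subseteq> X \<and> D_Cauchy d s \<longrightarrow> (\<exists>a\<in>X. D_converges d s a))"

definition D_compact :: "'a set \<Rightarrow> ('a \<Rightarrow> 'a \<Rightarrow> hyperbolic) \<Rightarrow> bool" where
  "D_compact X d \<longleftrightarrow>
     (\<forall>s. range s \<subseteq> X \<longrightarrow>
        (\<exists>a\<in>X. \<exists>r. strict_mono (r :: nat \<Rightarrow> nat) \<and> D_converges d (s \<circ> r) a))"

definition D_continuous ::
  "'a set \<Rightarrow> ('a \<Rightarrow> 'a \<Rightarrow> hyperbolic) \<Rightarrow> ('b \<Rightarrow> 'b \<Rightarrow> hyperbolic) \<Rightarrow> ('a \<Rightarrow> 'b) \<Rightarrow> bool" where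
  "D_continuous X d \<rho> f \<longleftrightarrow>
     (\<forall>a\<in>X. \<forall>\<epsilon>\<in>hyp_pos. \<exists>\<delta>\<in>hyp_pos. \<forall>x\<in>X. d x a \<prec>\<^sub>D \<delta> \<longrightarrow> \<rho> (f x) (f a) \<prec>\<^sub>D \<epsilon>)"

text \<open>Extensional functions, so that two elements are equal as soon as they agree on \<open>X\<close>.\<close>

definition D_cont_funs ::
  "'a set \<Rightarrow> ('a \<Rightarrow> 'a \<Rightarrow> hyperbolic) \<Rightarrow> 'b set \<Rightarrow> ('b \<Rightarrow> 'b \<Rightarrow> hyperbolic) \<Rightarrow> ('a \<Rightarrow> 'b) set" where
  "D_cont_funs X d Y \<rho> = {f \<in> X \<rightarrow>\<^sub>E Y. D_continuous X d \<rho> f}"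

definition D_sup_dist ::
  "'a set \<Rightarrow> ('b \<Rightarrow> 'b \<Rightarrow> hyperbolic) \<Rightarrow> ('a \<Rightarrow> 'b) \<Rightarrow> ('a \<Rightarrow> 'b) \<Rightarrow> hyperbolic" where
  "D_sup_dist X \<rho> f g = hyp_Sup {\<rho> (f x) (g x) | x. x \<in> X}"

end

theory Submission
  imports Defs
begin

text \<open>The idea is to measure a hyperbolic number \<open>z\<close> by the larger of its two idempotent
  components. Below every positive hyperbolic number lies a scalar \<open>of_real e\<close> with \<open>e > 0\<close>
  (\<open>hyp_pos_scalar_below\<close>), so convergence, the Cauchy property and continuity with respect to a
  hyperbolic distance \<open>d\<close> are the usual notions for the real distance
  \<open>\<lambda>x y. hyp_max (d x y)\<close>, which satisfies the triangle inequality because \<open>hyp_max\<close> is monotone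
  and subadditive.

  After this translation the classical arguments apply. Two continuous functions on a sequentially
  compact space stay at bounded distance: along a convergent subsequence of points where the
  distance exceeds \<open>n\<close>, continuity at the limit would bound it
  (\<open>D_cont_funs_bdd_above\<close>). Hence the supremum is a genuine one, and the metric axioms pass from
  \<open>\<rho>\<close> to it componentwise (\<open>D_metric_space_sup_dist\<close>). For completeness, a sequence that is Cauchy
  in the supremum distance is Cauchy at each point, with an index independent of the point. Its
  pointwise limit is therefore a uniform limit, and uniform limits of continuous functions are
  continuous (\<open>D_complete_cont_funs\<close>).\<close>

section \<open>Measuring hyperbolic numbers by one real number\<close>

definition hyp_max :: "hyperbolic \<Rightarrow> real" where
  "hyp_max z = max (comp1 z) (comp2 z)"

lemma comp_of_real [simp]: "comp1 (of_real r) = r" "comp2 (of_real r) = r"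
  by (simp_all add: of_real_def comp1_def comp2_def hyperbolic_ops_defs)

lemma hyperbolic_eq_iff_comp: "x = y \<longleftrightarrow> comp1 x = comp1 y \<and> comp2 x = comp2 y"
  by (auto simp: hyperbolic_eq_iff comp1_def comp2_def)

lemma hyp_le_trans: "x \<preceq>\<^sub>D y \<Longrightarrow> y \<preceq>\<^sub>D z \<Longrightarrow> x \<preceq>\<^sub>D z"
  by (auto simp: hyp_le_def)

lemma hyp_le_add_mono: "x \<preceq>\<^sub>D x' \<Longrightarrow> y \<preceq>\<^sub>D y' \<Longrightarrow> x + y \<preceq>\<^sub>D x' + y'"
  by (simp add: hyp_le_def add_mono)

lemma hyp_le_antisym: "x \<preceq>\<^sub>D y \<Longrightarrow> y \<preceq>\<^sub>D x \<Longrightarrow> x = y"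
  by (simp add: hyp_le_def hyperbolic_eq_iff_comp)

lemma hyp_max_mono: "x \<preceq>\<^sub>D y \<Longrightarrow> hyp_max x \<le> hyp_max y"
  by (auto simp: hyp_le_def hyp_max_def)

lemma hyp_max_add: "hyp_max (x + y) \<le> hyp_max x + hyp_max y"
  by (auto simp: hyp_max_def)

lemma hyp_less_of_real_iff: "x \<prec>\<^sub>D of_real e \<longleftrightarrow> hyp_max x < e"
  by (auto simp: hyp_less_def hyp_max_def)

lemma of_real_in_hyp_pos_iff: "of_real e \<in> hyp_pos \<longleftrightarrow> 0 < e"
  by (simp add: hyp_pos_def)

text \<open>The smaller component of \<open>\<epsilon>\<close> serves as \<open>e\<close>. This is the direction of the translations to
  real distances in which an arbitrary \<open>\<epsilon>\<close>, with possibly very different components, has to be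
  replaced by a single real number.\<close>

lemma hyp_pos_scalar_below:
  assumes "\<epsilon> \<in> hyp_pos"
  shows "\<exists>e>0. \<forall>x. hyp_max x < e \<longrightarrow> x \<prec>\<^sub>D \<epsilon>"
proof (intro exI conjI allI impI)
  show "0 < min (comp1 \<epsilon>) (comp2 \<epsilon>)"
    using assms by (simp add: hyp_pos_def)
  show "x \<prec>\<^sub>D \<epsilon>" if "hyp_max x < min (comp1 \<epsilon>) (comp2 \<epsilon>)" for x
    using that by (auto simp: hyp_less_def hyp_max_def)
qed

lemma D_converges_iff_hyp_max:
  "D_converges d s a \<longleftrightarrow> (\<forall>e>0. \<exists>N. \<forall>n\<ge>N. hyp_max (d (s n) a) < e)"
proof
  assume "D_converges d s a"
  then show "\<forall>e>0. \<exists>N. \<forall>n\<ge>N. hyp_max (d (s n) a) < e"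
    unfolding D_converges_def by (metis hyp_less_of_real_iff of_real_in_hyp_pos_iff)
next
  assume "\<forall>e>0. \<exists>N. \<forall>n\<ge>N. hyp_max (d (s n) a) < e"
  then show "D_converges d s a"
    unfolding D_converges_def using hyp_pos_scalar_below by meson
qed

lemma D_Cauchy_iff_hyp_max:
  "D_Cauchy d s \<longleftrightarrow> (\<forall>e>0. \<exists>N. \<forall>n\<ge>N. \<forall>m\<ge>N. hyp_max (d (s n) (s m)) < e)"
proof
  assume "D_Cauchy d s"
  then show "\<forall>e>0. \<exists>N. \<forall>n\<ge>N. \<forall>m\<ge>N. hyp_max (d (s n) (s m)) < e"
    unfolding D_Cauchy_def by (metis hyp_less_of_real_iff of_real_in_hyp_pos_iff)
next
  assume "\<forall>e>0. \<exists>N. \<forall>n\<ge>N. \<forall>m\<ge>N. hyp_max (d (s n) (s m)) < e"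
  then show "D_Cauchy d s"
    unfolding D_Cauchy_def using hyp_pos_scalar_below by meson
qed

lemma D_continuous_iff_hyp_max:
  "D_continuous X d \<rho> f \<longleftrightarrow>
     (\<forall>a\<in>X. \<forall>e>0. \<exists>\<delta>>0. \<forall>x\<in>X. hyp_max (d x a) < \<delta> \<longrightarrow> hyp_max (\<rho> (f x) (f a)) < e)"
    (is "_ \<longleftrightarrow> ?real")
proof
  assume cont: "D_continuous X d \<rho> f"
  show ?real
  proof (intro ballI allI impI)
    fix a and e :: real
    assume "a \<in> X" "0 < e"
    then obtain \<delta> where "\<delta> \<in> hyp_pos"
      and \<delta>: "\<And>x. x \<in> X \<Longrightarrow> d x a \<prec>\<^sub>D \<delta> \<Longrightarrow> hyp_max (\<rho> (f x) (f a)) < e"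
      using cont unfolding D_continuous_def
      by (metis hyp_less_of_real_iff of_real_in_hyp_pos_iff)
    from \<open>\<delta> \<in> hyp_pos\<close> obtain r where "0 < r" "\<And>z. hyp_max z < r \<Longrightarrow> z \<prec>\<^sub>D \<delta>"
      using hyp_pos_scalar_below by blast
    with \<delta> show "\<exists>\<delta>>0. \<forall>x\<in>X. hyp_max (d x a) < \<delta> \<longrightarrow> hyp_max (\<rho> (f x) (f a)) < e"
      by blast
  qed
next
  assume real: ?real
  show "D_continuous X d \<rho> f"
    unfolding D_continuous_def
  proof (intro ballI)
    fix a \<epsilon>
    assume "a \<in> X" "\<epsilon> \<in> hyp_pos"
    from \<open>\<epsilon> \<in> hyp_pos\<close> obtain e where "0 < e" and e: "\<And>z. hyp_max z < e \<Longrightarrow> z \<prec>\<^sub>D \<epsilon>"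
      using hyp_pos_scalar_below by blast
    obtain r where "0 < r" "\<And>x. x \<in> X \<Longrightarrow> hyp_max (d x a) < r \<Longrightarrow> hyp_max (\<rho> (f x) (f a)) < e"
      using real \<open>a \<in> X\<close> \<open>0 < e\<close> by blast
    with e show "\<exists>\<delta>\<in>hyp_pos. \<forall>x\<in>X. d x a \<prec>\<^sub>D \<delta> \<longrightarrow> \<rho> (f x) (f a) \<prec>\<^sub>D \<epsilon>"
      by (intro bexI[of _ "of_real r"])
        (auto simp: hyp_less_of_real_iff of_real_in_hyp_pos_iff)
  qed
qed

lemma hyp_bdd_above_iff_hyp_max: "hyp_bdd_above A \<longleftrightarrow> (\<exists>c. \<forall>a\<in>A. hyp_max a \<le> c)"
proof
  assume "hyp_bdd_above A"
  then show "\<exists>c. \<forall>a\<in>A. hyp_max a \<le> c"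
    unfolding hyp_bdd_above_def using hyp_max_mono by blast
next
  assume "\<exists>c. \<forall>a\<in>A. hyp_max a \<le> c"
  then obtain c where "\<forall>a\<in>A. hyp_max a \<le> c" ..
  then have "\<forall>a\<in>A. a \<preceq>\<^sub>D of_real c"
    by (simp add: hyp_le_def hyp_max_def)
  then show "hyp_bdd_above A"
    unfolding hyp_bdd_above_def ..
qed

section \<open>Suprema of bounded sets of hyperbolic numbers\<close>

lemma comp_hyp_Sup:
  "comp1 (hyp_Sup A) = Sup (comp1 ` A)" "comp2 (hyp_Sup A) = Sup (comp2 ` A)"
  using hyp_idempotent_decomposition[THEN iffD1, OF hyp_Sup_def] by simp_all

lemma hyp_Sup_upper:
  assumes "hyp_bdd_above A" "a \<in> A"
  shows "a \<preceq>\<^sub>D hyp_Sup A"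
proof -
  have "bdd_above (comp1 ` A)" "bdd_above (comp2 ` A)"
    using assms(1) by (auto simp: hyp_bdd_above_def hyp_le_def bdd_above_def)
  with assms(2) show ?thesis
    by (simp add: hyp_le_def comp_hyp_Sup cSUP_upper)
qed

lemma hyp_Sup_least:
  assumes "A \<noteq> {}" "\<And>a. a \<in> A \<Longrightarrow> a \<preceq>\<^sub>D b"
  shows "hyp_Sup A \<preceq>\<^sub>D b"
  using assms by (auto simp: hyp_le_def comp_hyp_Sup intro!: cSUP_least)

section \<open>Distances\<close>

lemma D_metric_triangle_hyp_max:
  assumes "D_metric_space X d" "x \<in> X" "y \<in> X" "z \<in> X"
  shows "hyp_max (d x y) \<le> hyp_max (d x z) + hyp_max (d z y)"
proof -
  have "d x y \<preceq>\<^sub>D d x z + d z y"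
    using assms unfolding D_metric_space_def by blast
  then show ?thesis
    using hyp_max_mono hyp_max_add order_trans by blast
qed

lemma D_metric_sym: "D_metric_space X d \<Longrightarrow> x \<in> X \<Longrightarrow> y \<in> X \<Longrightarrow> d x y = d y x"
  unfolding D_metric_space_def by blast

lemma D_metric_triangle3_hyp_max:
  assumes "D_metric_space X d" "x \<in> X" "y \<in> X" "u \<in> X" "v \<in> X"
  shows "hyp_max (d x y) \<le> hyp_max (d x u) + hyp_max (d u v) + hyp_max (d v y)"
  using D_metric_triangle_hyp_max[of X d x y u] D_metric_triangle_hyp_max[of X d u y v] assms
  by linarith

lemma D_cont_funs_in: "f \<in> D_cont_funs X d Y \<rho> \<Longrightarrow> x \<in> X \<Longrightarrow> f x \<in> Y"
  by (auto simp: D_cont_funs_def)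

lemma D_cont_funs_const:
  assumes "D_metric_space Y \<rho>" "c \<in> Y"
  shows "(\<lambda>x\<in>X. c) \<in> D_cont_funs X d Y \<rho>"
proof -
  have "\<rho> c c = 0"
    using assms unfolding D_metric_space_def by blast
  then have "D_continuous X d \<rho> (\<lambda>x\<in>X. c)"
    by (auto simp: D_continuous_iff_hyp_max hyp_max_def intro: exI[of _ 1])
  with assms(2) show ?thesis
    by (auto simp: D_cont_funs_def)
qed

text \<open>If the distances were unbounded, points \<open>s n\<close> with distance above \<open>n\<close> would accumulate at some
  \<open>a\<close>. But near \<open>a\<close> the distance is at most that of \<open>f a\<close> and \<open>g a\<close> plus \<open>2\<close>, by continuity of
  both functions.\<close>

lemma D_cont_funs_bdd_above:
  assumes Y: "D_metric_space Y \<rho>" and compact: "D_compact X d"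
    and f: "f \<in> D_cont_funs X d Y \<rho>" and g: "g \<in> D_cont_funs X d Y \<rho>"
  shows "hyp_bdd_above {\<rho> (f x) (g x) | x. x \<in> X}"
proof (rule ccontr)
  assume "\<not> ?thesis"
  then have "\<forall>n::nat. \<exists>x\<in>X. hyp_max (\<rho> (f x) (g x)) > real n"
    by (auto simp: hyp_bdd_above_iff_hyp_max not_le)
  then obtain s where sX: "\<And>n. s n \<in> X"
    and large: "\<And>n::nat. hyp_max (\<rho> (f (s n)) (g (s n))) > real n"
    by metis
  then obtain a r where "a \<in> X" "strict_mono (r :: nat \<Rightarrow> nat)" and conv: "D_converges d (s \<circ> r) a"
    using compact unfolding D_compact_def by (metis image_subsetI)
  have near: "\<exists>\<delta>>0. \<forall>x\<in>X. hyp_max (d x a) < \<delta> \<longrightarrow> hyp_max (\<rho> (h x) (h a)) < 1"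
    if "h \<in> D_cont_funs X d Y \<rho>" for h
    using that \<open>a \<in> X\<close> by (simp add: D_cont_funs_def D_continuous_iff_hyp_max)
  obtain \<delta>f where "\<delta>f > 0"
    and \<delta>f: "\<And>x. x \<in> X \<Longrightarrow> hyp_max (d x a) < \<delta>f \<Longrightarrow> hyp_max (\<rho> (f x) (f a)) < 1"
    using near[OF f] by blast
  obtain \<delta>g where "\<delta>g > 0"
    and \<delta>g: "\<And>x. x \<in> X \<Longrightarrow> hyp_max (d x a) < \<delta>g \<Longrightarrow> hyp_max (\<rho> (g x) (g a)) < 1"
    using near[OF g] by blast
  have "0 < min \<delta>f \<delta>g"
    using \<open>\<delta>f > 0\<close> \<open>\<delta>g > 0\<close> by simp
  then obtain N where N: "\<And>n. n \<ge> N \<Longrightarrow> hyp_max (d (s (r n)) a) < min \<delta>f \<delta>g"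
    using conv unfolding D_converges_iff_hyp_max comp_def by blast
  define c where "c = hyp_max (\<rho> (f a) (g a))"
  define n where "n = max N (nat \<lceil>c + 2\<rceil>)"
  define x where "x = s (r n)"
  have "x \<in> X" and "hyp_max (d x a) < min \<delta>f \<delta>g"
    using sX N by (simp_all add: x_def n_def)
  then have "hyp_max (\<rho> (f x) (f a)) < 1" "hyp_max (\<rho> (g x) (g a)) < 1"
    using \<delta>f \<delta>g by simp_all
  moreover have in_Y: "f x \<in> Y" "f a \<in> Y" "g x \<in> Y" "g a \<in> Y"
    using f g \<open>x \<in> X\<close> \<open>a \<in> X\<close> by (simp_all add: D_cont_funs_in)
  ultimately have "hyp_max (\<rho> (f x) (g x)) < c + 2"
    using D_metric_triangle3_hyp_max[OF Y, of "f x" "g x" "f a" "g a"] D_metric_sym[OF Y, of "g a" "g x"]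
    unfolding c_def by simp
  moreover have "c + 2 \<le> real (r n)"
  proof -
    have "c + 2 \<le> real n"
      unfolding n_def by linarith
    also have "real n \<le> real (r n)"
      using seq_suble[OF \<open>strict_mono r\<close>] by simp
    finally show ?thesis .
  qed
  ultimately show False
    using large[of "r n"] unfolding x_def by linarith
qed

section \<open>The supremum distance\<close>

lemma D_sup_dist_upper:
  assumes "hyp_bdd_above {\<rho> (f x) (g x) | x. x \<in> X}" "x \<in> X"
  shows "\<rho> (f x) (g x) \<preceq>\<^sub>D D_sup_dist X \<rho> f g"
  unfolding D_sup_dist_def using assms by (blast intro: hyp_Sup_upper)

lemma D_sup_dist_least:
  assumes "X \<noteq> {}" "\<And>x. x \<in> X \<Longrightarrow> \<rho> (f x) (g x) \<preceq>\<^sub>D b"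
  shows "D_sup_dist X \<rho> f g \<preceq>\<^sub>D b"
  unfolding D_sup_dist_def using assms by (intro hyp_Sup_least) blast+

text \<open>A bound \<open>c\<close> on the larger component bounds both components, so \<open>of_real c\<close> is an upper bound
  in the hyperbolic order and dominates the supremum.\<close>

lemma hyp_max_sup_dist_le:
  assumes "X \<noteq> {}" "\<And>x. x \<in> X \<Longrightarrow> hyp_max (\<rho> (f x) (g x)) \<le> c"
  shows "hyp_max (D_sup_dist X \<rho> f g) \<le> c"
proof -
  have "D_sup_dist X \<rho> f g \<preceq>\<^sub>D of_real c"
    using assms by (intro D_sup_dist_least) (auto simp: hyp_le_def hyp_max_def)
  then show ?thesis
    by (simp add: hyp_le_def hyp_max_def)
qed

text \<open>This isolates the hypotheses that make a supremum distance a metric on a set \<open>F\<close> of functions: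
  pairwise boundedness, and extensionality so that functions agreeing on \<open>X\<close> are equal.\<close>

lemma D_metric_space_sup_dist:
  assumes Y: "D_metric_space Y \<rho>" and "X \<noteq> {}" and "F \<noteq> {}" and F: "F \<subseteq> X \<rightarrow>\<^sub>E Y"
    and bdd: "\<And>f g. f \<in> F \<Longrightarrow> g \<in> F \<Longrightarrow> hyp_bdd_above {\<rho> (f x) (g x) | x. x \<in> X}"
  shows "D_metric_space F (D_sup_dist X \<rho>)"
proof -
  have in_Y: "f x \<in> Y" if "f \<in> F" "x \<in> X" for f x
    using F that by blast
  have upper: "\<rho> (f x) (g x) \<preceq>\<^sub>D D_sup_dist X \<rho> f g" if "f \<in> F" "g \<in> F" "x \<in> X" for f g x
    using bdd[OF that(1,2)] that(3) by (rule D_sup_dist_upper)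
  obtain x0 where "x0 \<in> X"
    using \<open>X \<noteq> {}\<close> by blast
  have nonneg\<rho>: "0 \<preceq>\<^sub>D \<rho> y z" if "y \<in> Y" "z \<in> Y" for y z
    using Y that unfolding D_metric_space_def hyp_nonneg_def hyp_le_def by simp
  have zero\<rho>: "\<rho> y z = 0 \<longleftrightarrow> y = z" if "y \<in> Y" "z \<in> Y" for y z
    using Y that unfolding D_metric_space_def by blast
  have triangle\<rho>: "\<rho> y z \<preceq>\<^sub>D \<rho> y w + \<rho> w z" if "y \<in> Y" "z \<in> Y" "w \<in> Y" for y z w
    using Y that unfolding D_metric_space_def by blast
  have nonneg: "0 \<preceq>\<^sub>D D_sup_dist X \<rho> f g" if "f \<in> F" "g \<in> F" for f g
    using nonneg\<rho>[OF in_Y in_Y, OF that(1) \<open>x0 \<in> X\<close> that(2) \<open>x0 \<in> X\<close>] upper[OF that \<open>x0 \<in> X\<close>]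
    by (rule hyp_le_trans)
  have zero: "D_sup_dist X \<rho> f g = 0 \<longleftrightarrow> f = g" if fg: "f \<in> F" "g \<in> F" for f g
  proof
    assume eq: "D_sup_dist X \<rho> f g = 0"
    have "f x = g x" if "x \<in> X" for x
    proof -
      have "\<rho> (f x) (g x) = 0"
        using upper[OF fg that, unfolded eq] nonneg\<rho>[OF in_Y in_Y, OF fg(1) that fg(2) that]
        by (rule hyp_le_antisym)
      then show ?thesis
        using zero\<rho> in_Y fg that by blast
    qed
    then show "f = g"
      by (rule PiE_ext[OF subsetD[OF F fg(1)] subsetD[OF F fg(2)]])
  next
    assume "f = g"
    then have "\<rho> (f x) (g x) \<preceq>\<^sub>D 0" if "x \<in> X" for x
      using zero\<rho>[of "f x" "g x"] in_Y fg that by (simp add: hyp_le_def)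
    then have "D_sup_dist X \<rho> f g \<preceq>\<^sub>D 0"
      using \<open>X \<noteq> {}\<close> by (rule D_sup_dist_least[rotated])
    then show "D_sup_dist X \<rho> f g = 0"
      using nonneg[OF fg] by (rule hyp_le_antisym)
  qed
  have sym: "D_sup_dist X \<rho> f g = D_sup_dist X \<rho> g f" if "f \<in> F" "g \<in> F" for f g
  proof -
    have "{\<rho> (f x) (g x) | x. x \<in> X} = {\<rho> (g x) (f x) | x. x \<in> X}"
      by (intro Collect_cong ex_cong1) (auto simp: in_Y that D_metric_sym[OF Y, of "f _" "g _"])
    then show ?thesis
      by (simp add: D_sup_dist_def)
  qed
  have triangle: "D_sup_dist X \<rho> f g \<preceq>\<^sub>D D_sup_dist X \<rho> f h + D_sup_dist X \<rho> h g"
    if fgh: "f \<in> F" "g \<in> F" "h \<in> F" for f g h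
  proof (rule D_sup_dist_least[OF \<open>X \<noteq> {}\<close>])
    fix x
    assume "x \<in> X"
    then have "\<rho> (f x) (g x) \<preceq>\<^sub>D \<rho> (f x) (h x) + \<rho> (h x) (g x)"
      by (simp add: triangle\<rho> in_Y fgh)
    moreover have "\<rho> (f x) (h x) + \<rho> (h x) (g x) \<preceq>\<^sub>D D_sup_dist X \<rho> f h + D_sup_dist X \<rho> h g"
      by (simp add: hyp_le_add_mono upper fgh \<open>x \<in> X\<close>)
    ultimately show "\<rho> (f x) (g x) \<preceq>\<^sub>D D_sup_dist X \<rho> f h + D_sup_dist X \<rho> h g"
      by (rule hyp_le_trans)
  qed
  show ?thesis
    unfolding D_metric_space_def
  proof (intro conjI ballI)
    show "D_sup_dist X \<rho> f g \<in> hyp_nonneg" if "f \<in> F" "g \<in> F" for f g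
      using nonneg[OF that] by (simp add: hyp_nonneg_def hyp_le_def)
  qed (fact \<open>F \<noteq> {}\<close> zero sym triangle)+
qed

section \<open>Completeness\<close>

text \<open>The estimate through one approximant \<open>h\<close>: continuity of \<open>h\<close> controls the middle term of
  \<open>f x, h x, h a, f a\<close>, and uniform closeness the outer two.\<close>

lemma D_continuous_uniform_limit:
  assumes Y: "D_metric_space Y \<rho>" and f: "\<And>x. x \<in> X \<Longrightarrow> f x \<in> Y"
    and approx: "\<And>e. 0 < e \<Longrightarrow>
      \<exists>h\<in>D_cont_funs X d Y \<rho>. \<forall>x\<in>X. hyp_max (\<rho> (h x) (f x)) < e"
  shows "D_continuous X d \<rho> f"
  unfolding D_continuous_iff_hyp_max
proof (intro ballI allI impI)
  fix a and e :: real
  assume "a \<in> X" "0 < e"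
  then have "0 < e / 3"
    by simp
  from approx[OF this] obtain h where h: "h \<in> D_cont_funs X d Y \<rho>"
    and close: "\<And>x. x \<in> X \<Longrightarrow> hyp_max (\<rho> (h x) (f x)) < e / 3"
    by blast
  from h \<open>a \<in> X\<close> \<open>0 < e / 3\<close> obtain \<delta> where "\<delta> > 0"
    and \<delta>: "\<And>x. x \<in> X \<Longrightarrow> hyp_max (d x a) < \<delta> \<Longrightarrow> hyp_max (\<rho> (h x) (h a)) < e / 3"
    unfolding D_cont_funs_def D_continuous_iff_hyp_max by blast
  have "hyp_max (\<rho> (f x) (f a)) < e" if "x \<in> X" "hyp_max (d x a) < \<delta>" for x
  proof -
    have in_Y: "f x \<in> Y" "f a \<in> Y" "h x \<in> Y" "h a \<in> Y"
      using f D_cont_funs_in[OF h] that \<open>a \<in> X\<close> by simp_all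
    then show ?thesis
      using D_metric_triangle3_hyp_max[OF Y, of "f x" "f a" "h x" "h a"]
        D_metric_sym[OF Y, of "f x" "h x"] close[of x] close[of a] \<delta>[OF that] that \<open>a \<in> X\<close>
      by simp
  qed
  with \<open>\<delta> > 0\<close> show "\<exists>\<delta>>0. \<forall>x\<in>X. hyp_max (d x a) < \<delta> \<longrightarrow> hyp_max (\<rho> (f x) (f a)) < e"
    by blast
qed

lemma D_complete_cont_funs:
  assumes Y: "D_metric_space Y \<rho>" and "X \<noteq> {}" and complete: "D_complete Y \<rho>"
    and bdd: "\<And>f g. f \<in> D_cont_funs X d Y \<rho> \<Longrightarrow> g \<in> D_cont_funs X d Y \<rho> \<Longrightarrow>
      hyp_bdd_above {\<rho> (f x) (g x) | x. x \<in> X}"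
  shows "D_complete (D_cont_funs X d Y \<rho>) (D_sup_dist X \<rho>)"
  unfolding D_complete_def
proof (intro allI impI, elim conjE)
  fix s
  assume "range s \<subseteq> D_cont_funs X d Y \<rho>" and cauchy: "D_Cauchy (D_sup_dist X \<rho>) s"
  then have s: "s n \<in> D_cont_funs X d Y \<rho>" for n
    by blast
  then have in_Y: "s n x \<in> Y" if "x \<in> X" for n x
    using that by (rule D_cont_funs_in)
  have unif_cauchy: "\<exists>N. \<forall>n\<ge>N. \<forall>m\<ge>N. \<forall>x\<in>X. hyp_max (\<rho> (s n x) (s m x)) < e" if "0 < e" for e
  proof -
    obtain N where "\<And>n m. n \<ge> N \<Longrightarrow> m \<ge> N \<Longrightarrow> hyp_max (D_sup_dist X \<rho> (s n) (s m)) < e"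
      using cauchy \<open>0 < e\<close> unfolding D_Cauchy_iff_hyp_max by blast
    moreover have "hyp_max (\<rho> (s n x) (s m x)) \<le> hyp_max (D_sup_dist X \<rho> (s n) (s m))"
      if "x \<in> X" for n m x
      using bdd[OF s s] that by (intro hyp_max_mono D_sup_dist_upper)
    ultimately show ?thesis
      using le_less_trans by blast
  qed
  have "\<exists>y\<in>Y. D_converges \<rho> (\<lambda>n. s n x) y" if "x \<in> X" for x
  proof -
    have "D_Cauchy \<rho> (\<lambda>n. s n x)"
      using unif_cauchy that unfolding D_Cauchy_iff_hyp_max by blast
    moreover have "range (\<lambda>n. s n x) \<subseteq> Y"
      using in_Y[OF that] by blast
    ultimately show ?thesis
      using complete unfolding D_complete_def by simp
  qed
  then obtain l where l: "\<And>x. x \<in> X \<Longrightarrow> l x \<in> Y \<and> D_converges \<rho> (\<lambda>n. s n x) (l x)"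
    by metis
  define f where "f = restrict l X"
  have f_in_Y: "f x \<in> Y" and f_lim: "D_converges \<rho> (\<lambda>n. s n x) (f x)" if "x \<in> X" for x
    using l that by (simp_all add: f_def)
  have unif: "\<exists>N. \<forall>n\<ge>N. \<forall>x\<in>X. hyp_max (\<rho> (s n x) (f x)) < e" if "0 < e" for e
  proof -
    from \<open>0 < e\<close> have "0 < e / 2"
      by simp
    from unif_cauchy[OF this] obtain N where
      N: "\<And>n m x. n \<ge> N \<Longrightarrow> m \<ge> N \<Longrightarrow> x \<in> X \<Longrightarrow> hyp_max (\<rho> (s n x) (s m x)) < e / 2"
      by blast
    have "hyp_max (\<rho> (s n x) (f x)) < e" if "n \<ge> N" "x \<in> X" for n x
    proof -
      \<comment> \<open>The comparison index may depend on \<open>x\<close>; it drops out of the resulting bound.\<close>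
      obtain M where M: "\<And>m. m \<ge> M \<Longrightarrow> hyp_max (\<rho> (s m x) (f x)) < e / 2"
        using f_lim[OF \<open>x \<in> X\<close>] \<open>0 < e / 2\<close> unfolding D_converges_iff_hyp_max by blast
      show ?thesis
        using N[of n "max N M" x] M[of "max N M"] that
          D_metric_triangle_hyp_max[OF Y in_Y[of x n] f_in_Y[of x] in_Y[of x "max N M"]]
        by simp
    qed
    then show ?thesis
      by blast
  qed
  have "D_continuous X d \<rho> f"
    using unif s by (intro D_continuous_uniform_limit[OF Y f_in_Y]) (auto, blast)
  then have "f \<in> D_cont_funs X d Y \<rho>"
    using f_in_Y by (auto simp: D_cont_funs_def f_def)
  moreover have "D_converges (D_sup_dist X \<rho>) s f"
    unfolding D_converges_iff_hyp_max
  proof (intro allI impI)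
    fix e :: real
    assume "0 < e"
    \<comment> \<open>A strict pointwise bound gives only a weak one for the supremum, hence \<open>e / 2\<close>.\<close>
    then have "0 < e / 2"
      by simp
    from unif[OF this] obtain N where
      "\<And>n x. n \<ge> N \<Longrightarrow> x \<in> X \<Longrightarrow> hyp_max (\<rho> (s n x) (f x)) < e / 2"
      by blast
    then have "hyp_max (D_sup_dist X \<rho> (s n) f) \<le> e / 2" if "n \<ge> N" for n
      using \<open>X \<noteq> {}\<close> that by (intro hyp_max_sup_dist_le) (auto intro: less_imp_le)
    with \<open>0 < e\<close> show "\<exists>N. \<forall>n\<ge>N. hyp_max (D_sup_dist X \<rho> (s n) f) < e"
      by (intro exI[of _ N]) force
  qed
  ultimately show "\<exists>f\<in>D_cont_funs X d Y \<rho>. D_converges (D_sup_dist X \<rho>) s f"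
    by blast
qed

section \<open>The space of continuous functions on a compact space\<close>

theorem theorem39:
  fixes X :: "'a set" and d :: "'a \<Rightarrow> 'a \<Rightarrow> hyperbolic"
    and Y :: "'b set" and \<rho> :: "'b \<Rightarrow> 'b \<Rightarrow> hyperbolic"
  assumes "D_metric_space X d" and "D_metric_space Y \<rho>" and "D_compact X d"
  shows "(\<forall>f\<in>D_cont_funs X d Y \<rho>. \<forall>g\<in>D_cont_funs X d Y \<rho>.
            hyp_bdd_above {\<rho> (f x) (g x) | x. x \<in> X}) \<and>
         D_metric_space (D_cont_funs X d Y \<rho>) (D_sup_dist X \<rho>) \<and>
         (D_complete Y \<rho> \<longrightarrow> D_complete (D_cont_funs X d Y \<rho>) (D_sup_dist X \<rho>))"
proof -
  have "X \<noteq> {}"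
    using assms(1) by (simp add: D_metric_space_def)
  have bdd: "hyp_bdd_above {\<rho> (f x) (g x) | x. x \<in> X}"
    if "f \<in> D_cont_funs X d Y \<rho>" "g \<in> D_cont_funs X d Y \<rho>" for f g
    using D_cont_funs_bdd_above[OF assms(2,3) that] .
  obtain c where "c \<in> Y"
    using assms(2) unfolding D_metric_space_def by blast
  then have "D_cont_funs X d Y \<rho> \<noteq> {}"
    using D_cont_funs_const[OF assms(2)] by blast
  moreover have "D_cont_funs X d Y \<rho> \<subseteq> X \<rightarrow>\<^sub>E Y"
    by (auto simp: D_cont_funs_def)
  ultimately have "D_metric_space (D_cont_funs X d Y \<rho>) (D_sup_dist X \<rho>)"
    using D_metric_space_sup_dist[OF assms(2) \<open>X \<noteq> {}\<close>] bdd by blast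
  then show ?thesis
    using bdd D_complete_cont_funs[OF assms(2) \<open>X \<noteq> {}\<close>] by blast
qed

end
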